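(* Let $Q$ and $Q'$ be two non-empty sets of primes with $Q \neq Q'$, and let $\mathcal E_Q$, $\mathcal E_{Q'}$ be the associated profinite coarse structures on $\mathbb Z$. Then the coarse groups $(\mathbb Z, \mathcal E_Q)$ and $(\mathbb Z, \mathcal E_{Q'})$ are not coarsely isomorphic.
   Context: For a non-empty set $Q$ of primes, let $Q^*$ be the set of positive integers $m$ with $\gcd(m,p)=1$ for every prime $p \notin Q$ (i.e. products of powers of primes in $Q$). Let $\mathbb Z_Q = \varprojlim_{m \in Q^*} \mathbb Z/m\mathbb Z$ with the limit topology (each finite quotient being discrete). The natural map $\mathbb Z \to \mathbb Z_Q$ is injective; let $\tau_Q$ be the topology induced on $\mathbb Z$ (the sets $k+m\mathbb Z$, $k \in \mathbb Z$, $m \in Q^*$, form a basis). The profinite coarse structure $\mathcal E_Q$ on $\mathbb Z$ is defined by declaring a family $(A_i)_{i\in I}$ of subsets of $\mathbb Z$ to be uniformly $\mathcal E_Q$-bounded if and only if there is a $\tau_Q$-compact subset $K \subset \mathbb Z$ such that for every $i\in I$ there is $k_i \in \mathbb Z$ with $A_i \subseteq k_i + K$. $(\mathbb Z,\mathcal E_Q)$ is regarded as a coarse group under addition. A function $f\colon (\mathbb Z,\mathcal E) \to (\mathbb Z, \mathcal E')$ is controlled if for every uniformly $\mathcal E$-bounded family $(A_i)_{i \in I}$ the family $(f(A_i))_{i\in I}$ is uniformly $\mathcal E'$-bounded. Two functions $f, f'\colon X \to (\mathbb Z,\mathcal E')$ defined on a set $X$ are close if the family $(\{f(x),f'(x)\})_{x\in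 X}$ is uniformly $\mathcal E'$-bounded. A controlled function $f\colon(\mathbb Z,\mathcal E) \to (\mathbb Z, \mathcal E')$ is a coarse equivalence if there is a controlled $h\colon (\mathbb Z,\mathcal E')\to(\mathbb Z,\mathcal E)$ such that $h\circ f$ and $f\circ h$ are close to the respective identity functions. The coarse groups $(\mathbb Z,\mathcal E)$ and $(\mathbb Z, \mathcal E')$ are coarsely isomorphic if there is a coarse equivalence $f\colon (\mathbb Z,\mathcal E) \to (\mathbb Z, \mathcal E')$ that is a coarse homomorphism, i.e. such that the functions $(a,b)\mapsto f(a+b)$ and $(a,b)\mapsto f(a)+f(b)$ from $\mathbb Z\times\mathbb Z$ to $(\mathbb Z,\mathcal E')$ are close. *)

theory Defs
  imports "HOL-Analysis.Analysis" "HOL-Computational_Algebra.Primes"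
begin

definition Q_star :: "nat set \<Rightarrow> nat set" where
  "Q_star Q = {m. m > 0 \<and> (\<forall>p. prime p \<and> p \<notin> Q \<longrightarrow> coprime m p)}"

text \<open>
  The inverse limit of the rings \<open>\<int>/m\<int>\<close> for \<open>m\<close> in \<open>Q_star Q\<close>, directed by divisibility, as a
  space of compatible sequences. The ring \<open>\<int>/m\<int>\<close> is represented by \<open>{0..<m}\<close>, so that the
  transition map to \<open>\<int>/m\<int>\<close> is reduction modulo \<open>m\<close>. Only the topology is needed below, not the
  ring structure.
\<close>

definition inverse_limit :: "nat set \<Rightarrow> (nat \<Rightarrow> int) set" where
  "inverse_limit Q =
    {x \<in> (\<Pi>\<^sub>E m\<in>Q_star Q. {0..<int m}).
       \<forall>m\<in>Q_star Q. \<forall>n\<in>Q_star Q. m dvd n \<longrightarrow> x n mod int m = x m}"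

definition inverse_limit_topology :: "nat set \<Rightarrow> (nat \<Rightarrow> int) topology" where
  "inverse_limit_topology Q =
    subtopology (product_topology (\<lambda>m. discrete_topology {0..<int m}) (Q_star Q)) (inverse_limit Q)"

definition natural_map :: "nat set \<Rightarrow> int \<Rightarrow> (nat \<Rightarrow> int)" where
  "natural_map Q k = (\<lambda>m\<in>Q_star Q. k mod int m)"

definition tau :: "nat set \<Rightarrow> int topology" where
  "tau Q = pullback_topology UNIV (natural_map Q) (inverse_limit_topology Q)"

text \<open>
  Uniform boundedness of a family \<open>(A i)\<close> with \<open>i \<in> I\<close> depends only on the collection \<open>A ` I\<close> of
  its members. A coarse structure on a type is therefore represented by the set of its uniformly
  bounded collections of subsets, which avoids a quantification over all index types.
\<close>

type_synonym 'a coarse_structure = "'a set set set"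

definition uniformly_bounded :: "'a coarse_structure \<Rightarrow> 'i set \<Rightarrow> ('i \<Rightarrow> 'a set) \<Rightarrow> bool" where
  "uniformly_bounded E I A \<longleftrightarrow> A ` I \<in> E"

definition profinite_coarse :: "nat set \<Rightarrow> int coarse_structure" where
  "profinite_coarse Q =
    {\<A>. \<exists>K. compactin (tau Q) K \<and> (\<forall>A\<in>\<A>. \<exists>k. A \<subseteq> (\<lambda>x. k + x) ` K)}"

definition controlled ::
    "'a coarse_structure \<Rightarrow> 'b coarse_structure \<Rightarrow> ('a \<Rightarrow> 'b) \<Rightarrow> bool" where
  "controlled E E' f \<longleftrightarrow>
    (\<forall>\<A>. uniformly_bounded E \<A> (\<lambda>A. A) \<longrightarrow> uniformly_bounded E' \<A> (\<lambda>A. f ` A))"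

definition close :: "'b coarse_structure \<Rightarrow> ('x \<Rightarrow> 'b) \<Rightarrow> ('x \<Rightarrow> 'b) \<Rightarrow> bool" where
  "close E' f f' \<longleftrightarrow> uniformly_bounded E' UNIV (\<lambda>x. {f x, f' x})"

definition coarse_equivalence ::
    "'a coarse_structure \<Rightarrow> 'b coarse_structure \<Rightarrow> ('a \<Rightarrow> 'b) \<Rightarrow> bool" where
  "coarse_equivalence E E' f \<longleftrightarrow>
    controlled E E' f \<and> (\<exists>h. controlled E' E h \<and> close E (h \<circ> f) id \<and> close E' (f \<circ> h) id)"

definition coarse_homomorphism :: "'b coarse_structure \<Rightarrow> ('a::plus \<Rightarrow> 'b::plus) \<Rightarrow> bool" where
  "coarse_homomorphism E' f \<longleftrightarrow> close E' (\<lambda>(a, b). f (a + b)) (\<lambda>(a, b). f a + f b)"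

definition coarsely_isomorphic ::
    "'a::plus coarse_structure \<Rightarrow> 'b::plus coarse_structure \<Rightarrow> bool" where
  "coarsely_isomorphic E E' \<longleftrightarrow> (\<exists>f. coarse_equivalence E E' f \<and> coarse_homomorphism E' f)"

lemma uniformly_bounded_profinite_coarse:
  "uniformly_bounded (profinite_coarse Q) I A \<longleftrightarrow>
    (\<exists>K. compactin (tau Q) K \<and> (\<forall>i\<in>I. \<exists>k. A i \<subseteq> (\<lambda>x. k + x) ` K))"
  unfolding uniformly_bounded_def profinite_coarse_def by simp

lemma controlled_uniformly_bounded:
  assumes "controlled E E' f" "uniformly_bounded E I A"
  shows "uniformly_bounded E' I (\<lambda>i. f ` A i)"
  using assms unfolding controlled_def uniformly_bounded_def by (auto simp: image_image)

lemma natural_map_in: "natural_map Q k \<in> inverse_limit Q"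
  by (auto simp: natural_map_def inverse_limit_def Q_star_def mod_mod_cancel)

lemma topspace_inverse_limit: "topspace (inverse_limit_topology Q) = inverse_limit Q"
  by (auto simp: inverse_limit_topology_def inverse_limit_def)

lemma topspace_tau [simp]: "topspace (tau Q) = UNIV"
  using natural_map_in by (auto simp: tau_def topspace_pullback_topology topspace_inverse_limit)

lemma Q_star_prod:
  assumes "finite F" "F \<subseteq> Q_star Q"
  shows "\<Prod>F \<in> Q_star Q"
  using assms by (auto simp: Q_star_def subset_eq intro!: prod_coprime_left prod_pos)

lemma prime_power_in_Q_star:
  assumes "Q \<subseteq> {p. prime p}" "p \<in> Q"
  shows "p ^ n \<in> Q_star Q"
  using assms by (auto simp: Q_star_def prime_gt_0_nat subset_eq intro!: coprime_power_left_iff[THEN iffD2])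
    (metis primes_coprime)

lemma inj_natural_map:
  assumes "Q \<noteq> {}" "Q \<subseteq> {p. prime p}"
  shows "inj (natural_map Q)"
proof (rule injI)
  fix a b assume eq: "natural_map Q a = natural_map Q b"
  obtain p where p: "p \<in> Q" "prime p" using assms by auto
  define n where "n = nat \<bar>a - b\<bar>"
  have pn: "p ^ n \<in> Q_star Q" using prime_power_in_Q_star assms p by blast
  have "a mod int (p ^ n) = b mod int (p ^ n)"
    using fun_cong[OF eq, of "p ^ n"] pn by (simp add: natural_map_def)
  then have "int (p ^ n) dvd a - b" by (simp add: mod_eq_dvd_iff)
  moreover have "n < p ^ n" using p(2) prime_gt_1_nat by (simp add: power_gt_expt)
  then have "\<bar>a - b\<bar> < int (p ^ n)" unfolding n_def by linarith
  ultimately show "a = b" using dvd_imp_le_int[of "a - b" "int (p ^ n)"] by auto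
qed

lemma openin_tau:
  "openin (tau Q) U \<longleftrightarrow> (\<forall>k\<in>U. \<exists>m\<in>Q_star Q. range (\<lambda>j. k + int m * j) \<subseteq> U)"
proof
  assume "openin (tau Q) U"
  then obtain V where V: "openin (product_topology (\<lambda>m. discrete_topology {0..<int m}) (Q_star Q)) V"
    and U: "U = natural_map Q -` V"
    using natural_map_in
    by (auto simp: tau_def openin_pullback_topology inverse_limit_topology_def openin_subtopology)
  show "\<forall>k\<in>U. \<exists>m\<in>Q_star Q. range (\<lambda>j. k + int m * j) \<subseteq> U"
  proof
    fix k assume "k \<in> U"
    then have "natural_map Q k \<in> V" using U by simp
    with V obtain W where W: "finite {m \<in> Q_star Q. W m \<noteq> {0..<int m}}"
      "natural_map Q k \<in> Pi\<^sub>E (Q_star Q) W" "Pi\<^sub>E (Q_star Q) W \<subseteq> V"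
      unfolding openin_product_topology_alt by auto
    define F where "F = {m \<in> Q_star Q. W m \<noteq> {0..<int m}}"
    have F: "finite F" "F \<subseteq> Q_star Q" using W by (auto simp: F_def)
    have "k + int (\<Prod>F) * j \<in> U" for j
    proof -
      have "(k + int (\<Prod>F) * j) mod int m \<in> W m" if m: "m \<in> Q_star Q" for m
      proof (cases "m \<in> F")
        case True
        then have "m dvd \<Prod>F" using F(1) by (metis dvd_prodI id_apply image_id)
        then have "int m dvd int (\<Prod>F) * j" by (meson dvd_mult2 int_dvd_int_iff)
        then have "(k + int (\<Prod>F) * j) mod int m = k mod int m"
          by (auto simp: mod_eq_dvd_iff)
        then show ?thesis using W(2) m by (auto simp: natural_map_def dest: PiE_mem)
      next
        case False
        then show ?thesis using m by (auto simp: F_def Q_star_def)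
      qed
      then have "natural_map Q (k + int (\<Prod>F) * j) \<in> Pi\<^sub>E (Q_star Q) W"
        by (auto simp: natural_map_def)
      then show ?thesis using W(3) U by auto
    qed
    then show "\<exists>m\<in>Q_star Q. range (\<lambda>j. k + int m * j) \<subseteq> U"
      using Q_star_prod[OF F] by blast
  qed
next
  assume *: "\<forall>k\<in>U. \<exists>m\<in>Q_star Q. range (\<lambda>j. k + int m * j) \<subseteq> U"
  show "openin (tau Q) U"
  proof (subst openin_subopen, intro ballI)
    fix k assume "k \<in> U"
    then obtain m where m: "m \<in> Q_star Q" "range (\<lambda>j. k + int m * j) \<subseteq> U" using * by blast
    let ?T = "product_topology (\<lambda>m. discrete_topology {0..<int m}) (Q_star Q)"
    let ?V = "{x \<in> topspace ?T. x m \<in> {k mod int m}}"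
    have "openin ?T ?V"
      by (rule openin_continuous_map_preimage[OF continuous_map_product_projection[OF m(1)]])
        (use m(1) in \<open>auto simp: Q_star_def\<close>)
    then have "openin (inverse_limit_topology Q) (?V \<inter> inverse_limit Q)"
      unfolding inverse_limit_topology_def openin_subtopology by blast
    then have "openin (tau Q) (natural_map Q -` (?V \<inter> inverse_limit Q))"
      unfolding tau_def openin_pullback_topology by auto
    moreover have "k \<in> natural_map Q -` (?V \<inter> inverse_limit Q)"
      using natural_map_in[of Q k] m(1) by (auto simp: inverse_limit_def natural_map_def)
    moreover have "natural_map Q -` (?V \<inter> inverse_limit Q) \<subseteq> U"
    proof
      fix l assume "l \<in> natural_map Q -` (?V \<inter> inverse_limit Q)"
      then have "l mod int m = k mod int m" using m(1) by (auto simp: natural_map_def)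
      then have "int m dvd l - k" by (simp add: mod_eq_dvd_iff)
      then obtain j where "l = k + int m * j" by (metis add.commute diff_add_cancel dvdE)
      then show "l \<in> U" using m(2) by auto
    qed
    ultimately show "\<exists>T. openin (tau Q) T \<and> k \<in> T \<and> T \<subseteq> U" by blast
  qed
qed

end

theory Submission
  imports Defs "HOL-Number_Theory.Cong"
begin

text \<open>
  Nonstandardly, a coarse isomorphism induces an isomorphism of the groups \<open>\<int>\<^sub>Q / \<int>\<close> and
  \<open>\<int>\<^sub>Q\<^sub>' / \<int>\<close>, and \<open>\<int>\<^sub>Q / \<int>\<close> has \<open>p\<close>-torsion (generated by \<open>1/p\<close>) exactly when \<open>p \<notin> Q\<close>.
  In terms of bounded sets, the absence of \<open>p\<close>-torsion says that \<open>A\<close> is bounded as soon as \<open>p A\<close> is.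
  If \<open>p \<in> Q\<close>, this holds because division by \<open>p\<close> is continuous. If \<open>p \<notin> Q\<close>, it fails for a
  sequence of integers converging to \<open>1/p\<close> in \<open>\<int>\<^sub>Q\<close>. The property is invariant under coarse
  isomorphisms \<open>f\<close>, since \<open>f (p a) - p f a\<close> stays in a compact set.
\<close>

text \<open>These are the bounded sets of \<open>profinite_coarse Q\<close>: a translate of a
  compact set is again compact, so no shift by some \<open>k\<close> appears.\<close>

definition relatively_compact :: "nat set \<Rightarrow> int set \<Rightarrow> bool" where
  "relatively_compact Q A \<longleftrightarrow> (\<exists>K. compactin (tau Q) K \<and> A \<subseteq> K)"

definition root_closed :: "nat set \<Rightarrow> nat \<Rightarrow> bool" where
  "root_closed Q p \<longleftrightarrow>
    (\<forall>A. relatively_compact Q ((\<lambda>a. int p * a) ` A) \<longrightarrow> relatively_compact Q A)"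

section \<open>Continuity of subtraction and of division\<close>

lemma openin_tau_residue_class:
  assumes "m \<in> Q_star Q"
  shows "openin (tau Q) (range (\<lambda>j. k + int m * j))"
  unfolding openin_tau
proof
  fix x assume "x \<in> range (\<lambda>j. k + int m * j)"
  then obtain i where "x = k + int m * i" by blast
  then have "x + int m * j = k + int m * (i + j)" for j
    by (simp add: algebra_simps)
  then have "range (\<lambda>j. x + int m * j) \<subseteq> range (\<lambda>j. k + int m * j)" by blast
  with assms show "\<exists>n\<in>Q_star Q. range (\<lambda>j. x + int n * j) \<subseteq> range (\<lambda>j. k + int m * j)"
    by blast
qed

text \<open>Subtracting the class of \<open>y\<close> from that of \<open>x\<close> modulo
  \<open>m\<close> stays in the class of \<open>x - y\<close> modulo \<open>m\<close>, with
  \<open>i - j\<close> as the new parameter.\<close>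

lemma continuous_map_tau_diff:
  "continuous_map (prod_topology (tau Q) (tau Q)) (tau Q) (\<lambda>(x, y). x - y)"
  unfolding continuous_map_def
proof (intro conjI allI impI)
  fix U assume U: "openin (tau Q) U"
  show "openin (prod_topology (tau Q) (tau Q))
    {z \<in> topspace (prod_topology (tau Q) (tau Q)). (case z of (x, y) \<Rightarrow> x - y) \<in> U}"
    unfolding openin_prod_topology_alt
  proof (intro allI impI)
    fix x y
    assume "(x, y) \<in> {z \<in> topspace (prod_topology (tau Q) (tau Q)). (case z of (x, y) \<Rightarrow> x - y) \<in> U}"
    then obtain m where m: "m \<in> Q_star Q" "range (\<lambda>j. (x - y) + int m * j) \<subseteq> U"
      using U by (auto simp: openin_tau)
    have "x + int m * i - (y + int m * j) \<in> U" for i j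
      using m(2) by (auto simp: algebra_simps image_subset_iff dest: spec[of _ "i - j"])
    then have "range (\<lambda>j. x + int m * j) \<times> range (\<lambda>j. y + int m * j)
      \<subseteq> {z \<in> topspace (prod_topology (tau Q) (tau Q)). (case z of (x, y) \<Rightarrow> x - y) \<in> U}"
      by auto
    moreover have "x \<in> range (\<lambda>j. x + int m * j)" "y \<in> range (\<lambda>j. y + int m * j)"
      by (auto intro: range_eqI[of _ _ 0])
    ultimately show "\<exists>U' V'. openin (tau Q) U' \<and> openin (tau Q) V' \<and> x \<in> U' \<and> y \<in> V' \<and> U' \<times> V'
      \<subseteq> {z \<in> topspace (prod_topology (tau Q) (tau Q)). (case z of (x, y) \<Rightarrow> x - y) \<in> U}"
      using openin_tau_residue_class[OF m(1)] by meson
  qed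
qed auto

text \<open>Rounding does no harm: a shift by a multiple of \<open>p * m\<close> keeps the remainder
  modulo \<open>p\<close> and moves the quotient by a multiple of \<open>m\<close>.\<close>

lemma continuous_map_tau_div:
  assumes "p \<in> Q_star Q"
  shows "continuous_map (tau Q) (tau Q) (\<lambda>x. x div int p)"
  unfolding continuous_map_def
proof (intro conjI allI impI)
  fix U assume U: "openin (tau Q) U"
  have "\<exists>n\<in>Q_star Q. range (\<lambda>j. k + int n * j) \<subseteq> {x. x div int p \<in> U}"
    if k: "k div int p \<in> U" for k
  proof -
    obtain m where m: "m \<in> Q_star Q" "range (\<lambda>j. k div int p + int m * j) \<subseteq> U"
      using U k unfolding openin_tau by blast
    have "(k + int (p * m) * j) div int p = k div int p + int m * j" for j
      using assms by (simp add: Q_star_def mult.assoc)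
    then have "range (\<lambda>j. k + int (p * m) * j) \<subseteq> {x. x div int p \<in> U}"
      using m(2) by auto
    moreover have "p * m \<in> Q_star Q" using assms m(1) by (auto simp: Q_star_def)
    ultimately show ?thesis by blast
  qed
  then show "openin (tau Q) {x \<in> topspace (tau Q). x div int p \<in> U}"
    by (auto simp: openin_tau)
qed simp

section \<open>Sums and differences of relatively compact sets\<close>

lemma relatively_compact_subset:
  "relatively_compact Q B \<Longrightarrow> A \<subseteq> B \<Longrightarrow> relatively_compact Q A"
  unfolding relatively_compact_def by blast

lemma relatively_compact_finite: "finite A \<Longrightarrow> relatively_compact Q A"
  unfolding relatively_compact_def using finite_imp_compactin[of A "tau Q"] by auto

text \<open>Subtraction is continuous and \<open>K \<times> L\<close> is compact. The elementwise
  condition on \<open>C\<close> suits sets whose members are only known to split as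
  differences.\<close>

lemma relatively_compact_diff:
  assumes "relatively_compact Q A" "relatively_compact Q B"
    and "\<And>c. c \<in> C \<Longrightarrow> \<exists>a\<in>A. \<exists>b\<in>B. c = a - b"
  shows "relatively_compact Q C"
proof -
  obtain K L where K: "compactin (tau Q) K" "A \<subseteq> K" and L: "compactin (tau Q) L" "B \<subseteq> L"
    using assms(1,2) unfolding relatively_compact_def by blast
  have "compactin (tau Q) ((\<lambda>(x, y). x - y) ` (K \<times> L))"
    using K L by (intro image_compactin[OF _ continuous_map_tau_diff]) (simp add: compactin_Times)
  moreover have "C \<subseteq> (\<lambda>(x, y). x - y) ` (K \<times> L)"
    using assms(3) K L by (fastforce simp: image_iff)
  ultimately show ?thesis unfolding relatively_compact_def by blast
qed

lemma relatively_compact_add: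
  assumes "relatively_compact Q A" "relatively_compact Q B"
    and "\<And>c. c \<in> C \<Longrightarrow> \<exists>a\<in>A. \<exists>b\<in>B. c = a + b"
  shows "relatively_compact Q C"
proof -
  \<comment> \<open>Negation is subtraction from \<open>0\<close>, and then a + b = a -
    (-b).\<close>
  have "relatively_compact Q (uminus ` B)"
    by (rule relatively_compact_diff[of Q "{0}" B]) (auto intro: relatively_compact_finite assms)
  with assms(1) show ?thesis
    by (rule relatively_compact_diff) (use assms(3) in force)
qed

section \<open>Relative compactness under close, controlled and homomorphic maps\<close>

lemma close_relatively_compact:
  assumes "close (profinite_coarse Q) f g"
  shows "relatively_compact Q (range (\<lambda>x. f x - g x))"
proof -
  obtain K where K: "compactin (tau Q) K" "\<And>x. \<exists>k. {f x, g x} \<subseteq> (\<lambda>y. k + y) ` K"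
    using assms unfolding close_def uniformly_bounded_profinite_coarse by blast
  \<comment> \<open>Both values lie in one translate of \<open>K\<close>, so the unknown shift
    cancels in the difference.\<close>
  have "\<exists>a\<in>K. \<exists>b\<in>K. f x - g x = a - b" for x
  proof -
    obtain k a b where "a \<in> K" "b \<in> K" "f x = k + a" "g x = k + b" using K(2)[of x] by auto
    moreover from this have "f x - g x = a - b" by simp
    ultimately show ?thesis by blast
  qed
  moreover have KK: "relatively_compact Q K" using K(1) unfolding relatively_compact_def by blast
  ultimately show ?thesis by (intro relatively_compact_diff[OF KK KK]) auto
qed

lemma controlled_relatively_compact:
  assumes "controlled (profinite_coarse Q) (profinite_coarse Q') f" "relatively_compact Q A"
  shows "relatively_compact Q' (f ` A)"
proof -
  obtain L where "compactin (tau Q) L" "A \<subseteq> L"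
    using assms(2) unfolding relatively_compact_def by blast
  moreover from this have "A \<subseteq> (\<lambda>x. 0 + x) ` L" by simp
  \<comment> \<open>A single set is treated as a family indexed by the one-point set.\<close>
  ultimately have "uniformly_bounded (profinite_coarse Q) {()} (\<lambda>_. A)"
    unfolding uniformly_bounded_profinite_coarse by blast
  then have "uniformly_bounded (profinite_coarse Q') {()} (\<lambda>_. f ` A)"
    by (rule controlled_uniformly_bounded[OF assms(1)])
  then obtain K k where "compactin (tau Q') K" "f ` A \<subseteq> (\<lambda>x. k + x) ` K"
    unfolding uniformly_bounded_profinite_coarse by blast
  moreover from this have K: "relatively_compact Q' K" unfolding relatively_compact_def by blast
  have k: "relatively_compact Q' {k}" by (rule relatively_compact_finite) simp
  ultimately show ?thesis by (intro relatively_compact_add[OF k K]) auto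
qed

text \<open>Passing from \<open>n\<close> to \<open>Suc n\<close> adds one homomorphism defect, at
  the pair \<open>(int n * a, a)\<close>. The bounding set may depend on \<open>n\<close> but not on
  \<open>a\<close>.\<close>

lemma coarse_homomorphism_multiple:
  assumes "coarse_homomorphism (profinite_coarse Q) (f :: int \<Rightarrow> int)"
  shows "relatively_compact Q (range (\<lambda>a. f (int n * a) - int n * f a))"
proof (induction n)
  case 0
  show ?case by (rule relatively_compact_finite) auto
next
  case (Suc n)
  have D: "relatively_compact Q (range (\<lambda>(a, b). f (a + b) - (f a + f b)))"
    using close_relatively_compact[OF assms[unfolded coarse_homomorphism_def]]
    by (simp add: case_prod_beta)
  show ?case
  proof (rule relatively_compact_add[OF Suc D])
    fix c assume "c \<in> range (\<lambda>a. f (int (Suc n) * a) - int (Suc n) * f a)"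
    then obtain a where "c = f (int (Suc n) * a) - int (Suc n) * f a" by blast
    then have "c = (f (int n * a) - int n * f a) +
        (case (int n * a, a) of (a, b) \<Rightarrow> f (a + b) - (f a + f b))"
      by (simp add: algebra_simps)
    then show "\<exists>a\<in>range (\<lambda>a. f (int n * a) - int n * f a).
      \<exists>b\<in>range (\<lambda>(a, b). f (a + b) - (f a + f b)). c = a + b" by blast
  qed
qed

lemma close_image_relatively_compact:
  assumes "relatively_compact Q (range (\<lambda>x. f x - g x))"
  shows "relatively_compact Q (f ` A) \<longleftrightarrow> relatively_compact Q (g ` A)"
proof
  assume "relatively_compact Q (f ` A)"
  from this assms show "relatively_compact Q (g ` A)"
  proof (rule relatively_compact_diff)
    fix c assume "c \<in> g ` A"
    then obtain x where "x \<in> A" "c = f x - (f x - g x)" by auto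
    then show "\<exists>a\<in>f ` A. \<exists>b\<in>range (\<lambda>x. f x - g x). c = a - b" by blast
  qed
next
  assume "relatively_compact Q (g ` A)"
  from this assms show "relatively_compact Q (f ` A)"
  proof (rule relatively_compact_add)
    fix c assume "c \<in> f ` A"
    then obtain x where "x \<in> A" "c = g x + (f x - g x)" by auto
    then show "\<exists>a\<in>g ` A. \<exists>b\<in>range (\<lambda>x. f x - g x). c = a + b" by blast
  qed
qed

section \<open>Invariance of \<open>root_closed\<close> under coarse isomorphism\<close>

lemma coarsely_isomorphic_root_closed:
  assumes "coarsely_isomorphic (profinite_coarse Q) (profinite_coarse Q')"
  shows "root_closed Q p \<longleftrightarrow> root_closed Q' p"
proof -
  obtain f h where
    f: "controlled (profinite_coarse Q) (profinite_coarse Q') f"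
      "coarse_homomorphism (profinite_coarse Q') f" and
    h: "controlled (profinite_coarse Q') (profinite_coarse Q) h" and
    hf: "close (profinite_coarse Q) (h \<circ> f) id" and
    fh: "close (profinite_coarse Q') (f \<circ> h) id"
    using assms unfolding coarsely_isomorphic_def coarse_equivalence_def by blast
  have hf_iff: "relatively_compact Q (h ` f ` A) \<longleftrightarrow> relatively_compact Q A" for A
    using close_image_relatively_compact[OF close_relatively_compact[OF hf], of A]
    by (simp add: image_comp)
  have fh_iff: "relatively_compact Q' (f ` h ` A) \<longleftrightarrow> relatively_compact Q' A" for A
    using close_image_relatively_compact[OF close_relatively_compact[OF fh], of A]
    by (simp add: image_comp)
  have f_iff: "relatively_compact Q' (f ` A) \<longleftrightarrow> relatively_compact Q A" for A
    using controlled_relatively_compact[OF f(1)] controlled_relatively_compact[OF h] hf_iff by blast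
  have h_iff: "relatively_compact Q (h ` A) \<longleftrightarrow> relatively_compact Q' A" for A
    using f_iff fh_iff by blast
  have mult_iff: "relatively_compact Q' ((\<lambda>a. int p * a) ` f ` A) \<longleftrightarrow>
    relatively_compact Q ((\<lambda>a. int p * a) ` A)" for A
    using close_image_relatively_compact[OF coarse_homomorphism_multiple[OF f(2)], of p A]
      f_iff[of "(\<lambda>a. int p * a) ` A"]
    by (simp add: image_image)
  \<comment> \<open>The homomorphism property is given for \<open>f\<close> only. Multiples of
    \<open>h b\<close> are therefore compared with multiples of \<open>b\<close> through
    \<open>int n * f (h b)\<close>, whose error is \<open>n\<close> times the bounded
    \<open>f (h b) - b\<close>.\<close>
  have fh_mult: "relatively_compact Q' (range (\<lambda>b. int n * f (h b) - int n * b))" for n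
  proof (induction n)
    case 0
    show ?case by (rule relatively_compact_finite) auto
  next
    case (Suc n)
    show ?case
      by (rule relatively_compact_add[OF Suc close_relatively_compact[OF fh]])
        (force simp: algebra_simps)
  qed
  have mult_h_iff: "relatively_compact Q ((\<lambda>a. int p * a) ` h ` B) \<longleftrightarrow>
    relatively_compact Q' ((\<lambda>b. int p * b) ` B)" for B
    using close_image_relatively_compact[OF fh_mult, of p B] mult_iff[of "h ` B"]
    by (simp add: image_image)
  show ?thesis
    \<comment> \<open>Each direction tests root closedness on an image: \<open>h\<close>
      B\<open>for sets\<close>B\<open>on the\<close>Q'\<open>side,\<close>f \<open>A\<close> for
      sets \<open>A\<close> on the \<open>Q\<close> side.\<close>
    unfolding root_closed_def using f_iff h_iff mult_iff mult_h_iff by metis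
qed

section \<open>The primes at which \<open>root_closed\<close> holds\<close>

lemma root_closed_if:
  assumes "p \<in> Q_star Q"
  shows "root_closed Q p"
  unfolding root_closed_def
proof (intro allI impI)
  fix A assume "relatively_compact Q ((\<lambda>a. int p * a) ` A)"
  then obtain K where K: "compactin (tau Q) K" "(\<lambda>a. int p * a) ` A \<subseteq> K"
    unfolding relatively_compact_def by blast
  have "compactin (tau Q) ((\<lambda>x. x div int p) ` K)"
    by (rule image_compactin[OF K(1) continuous_map_tau_div[OF assms]])
  moreover have "A \<subseteq> (\<lambda>x. x div int p) ` K"
  proof
    fix a assume "a \<in> A"
    moreover have "a = (int p * a) div int p" using assms by (simp add: Q_star_def)
    ultimately show "a \<in> (\<lambda>x. x div int p) ` K" using K(2) by blast
  qed
  ultimately show "relatively_compact Q A" unfolding relatively_compact_def by blast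
qed

lemma not_root_closed:
  assumes Q: "Q \<noteq> {}" "Q \<subseteq> {p. prime p}" and p: "prime p" "p \<notin> Q"
  shows "\<not> root_closed Q p"
proof
  assume root: "root_closed Q p"
  \<comment> \<open>\<open>M\<close> is cofinal for divisibility: every \<open>m\<close> in
    \<open>Q_star Q\<close> divides \<open>M n\<close> once \<open>m \<le> n\<close>.\<close>
  define M where "M n = \<Prod>(Q_star Q \<inter> {..n})" for n
  have M: "M n \<in> Q_star Q" for n
    unfolding M_def by (rule Q_star_prod) auto
  have dvd_M: "m dvd M n" if "m \<in> Q_star Q" "m \<le> n" for m n
    unfolding M_def using that by (metis IntI atMost_iff dvd_prodI finite_Int finite_atMost id_apply image_id)
  \<comment> \<open>As \<open>p\<close> is outside \<open>Q\<close>, it is invertible modulo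
    \<open>M n\<close>. The inverses \<open>a n\<close> approximate 1/p in the inverse
    limit.\<close>
  have "\<exists>a. [int p * a = 1] (mod int (M n))" for n
    using M[of n] p by (intro cong_solve_coprime_int) (auto simp: Q_star_def coprime_commute)
  then obtain a where a: "\<And>n. [int p * a n = 1] (mod int (M n))" by metis
  have a_cong: "[int p * a n = 1] (mod int m)" if "m \<in> Q_star Q" "m \<le> n" for m n
    using a[of n] dvd_M[OF that] by (meson cong_dvd_modulus int_dvd_int_iff)
  have "limitin (tau Q) (\<lambda>n. int p * a n) 1 sequentially"
    unfolding limitin_sequentially
  proof (intro conjI allI impI)
    fix U assume "openin (tau Q) U \<and> 1 \<in> U"
    then obtain m where m: "m \<in> Q_star Q" "range (\<lambda>j. 1 + int m * j) \<subseteq> U"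
      unfolding openin_tau by blast
    have "int p * a n \<in> U" if "m \<le> n" for n
    proof -
      have "int m dvd int p * a n - 1" using a_cong[OF m(1) that] by (simp add: cong_iff_dvd_diff)
      then obtain j where "int p * a n - 1 = int m * j" by (auto simp: dvd_def)
      then have "int p * a n = 1 + int m * j" by simp
      then show ?thesis using m(2) by auto
    qed
    then show "\<exists>N. \<forall>n\<ge>N. int p * a n \<in> U" by blast
  qed simp
  then have "compactin (tau Q) (insert 1 (range (\<lambda>n. int p * a n)))"
    by (rule compactin_sequence_with_limit) auto
  then have "relatively_compact Q ((\<lambda>x. int p * x) ` range a)"
    unfolding relatively_compact_def by (auto simp: image_image)
  then obtain K where K: "compactin (tau Q) K" "range a \<subseteq> K"
    using root unfolding root_closed_def relatively_compact_def by blast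
  \<comment> \<open>No integer \<open>c\<close> is 1/p, and injectivity of the natural map supplies
    a modulus that detects this.\<close>
  have "\<exists>m\<in>Q_star Q. \<not> [int p * c = 1] (mod int m)" for c
  proof -
    have "int p * c \<noteq> 1" using p(1) by (auto simp: zmult_eq_1_iff)
    then have "natural_map Q (int p * c) \<noteq> natural_map Q 1"
      using inj_natural_map[OF Q] by (auto dest: injD)
    then show ?thesis by (force simp: natural_map_def cong_def restrict_def fun_eq_iff split: if_splits)
  qed
  then obtain m where m: "\<And>c. m c \<in> Q_star Q" "\<And>c. \<not> [int p * c = 1] (mod int (m c))" by metis
  \<comment> \<open>On the class \<open>V c\<close> the congruence p x = 1 fails modulo
    \<open>m c\<close>, so \<open>a n\<close> lies outside \<open>V c\<close> for all
    \<open>n \<ge> m c\<close>. These classes form an open cover of \<open>K\<close>.\<close>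
  define V where "V c = range (\<lambda>j. c + int (m c) * j)" for c
  have "c \<in> V c" for c unfolding V_def by (rule range_eqI[of _ _ 0]) simp
  then have "K \<subseteq> \<Union>(range V)" by blast
  moreover have "\<And>U. U \<in> range V \<Longrightarrow> openin (tau Q) U"
    unfolding V_def using openin_tau_residue_class m(1) by blast
  ultimately obtain \<F> where "finite \<F>" "\<F> \<subseteq> range V" "K \<subseteq> \<Union>\<F>"
    using K(1) unfolding compactin_def by meson
  then obtain C where C: "finite C" "K \<subseteq> \<Union>(V ` C)" by (metis finite_subset_image)
  \<comment> \<open>This index is past every modulus of the finite subcover, so \<open>a n\<close>
    is in \<open>K\<close> but escapes the whole subcover.\<close>
  define n where "n = Max (insert 0 (m ` C))"
  obtain c where c: "c \<in> C" "a n \<in> V c" using C(2) K(2) by blast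
  have "m c \<le> n" unfolding n_def using C(1) c(1) by (auto intro: Max_ge)
  have "[a n = c] (mod int (m c))" using c(2) unfolding V_def by (auto simp: cong_iff_dvd_diff)
  then have "[int p * a n = int p * c] (mod int (m c))" by (rule cong_scalar_left)
  then show False
    using a_cong[OF m(1) \<open>m c \<le> n\<close>] m(2) by (metis cong_sym cong_trans)
qed

theorem theoremB:
  fixes Q Q' :: "nat set"
  assumes "Q \<noteq> {}" and "Q \<subseteq> {p. prime p}"
    and "Q' \<noteq> {}" and "Q' \<subseteq> {p. prime p}"
    and "Q \<noteq> Q'"
  shows "\<not> coarsely_isomorphic (profinite_coarse Q) (profinite_coarse Q')"
proof
  assume iso: "coarsely_isomorphic (profinite_coarse Q) (profinite_coarse Q')"
  \<comment> \<open>The invariant recovers \<open>R\<close> among the primes; exponent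
    \<open>1\<close> in \<open>prime_power_in_Q_star\<close> puts \<open>p\<close> itself into
    \<open>Q_star R\<close>.\<close>
  have root_iff: "root_closed R p \<longleftrightarrow> p \<in> R"
    if "R \<noteq> {}" "R \<subseteq> {p. prime p}" "prime p" for R p
    using not_root_closed root_closed_if prime_power_in_Q_star[of R p 1] that by auto
  have "p \<in> Q \<longleftrightarrow> p \<in> Q'" if "prime p" for p
    using coarsely_isomorphic_root_closed[OF iso] root_iff that assms(1-4) by metis
  then show False using assms(2,4,5) by blast
qed

end
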